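(* Let $(X,G)$ be a minimal system. Assume that $n\geq 2$ and that $X\times X$ has a dense set of minimal points. Then $(X,G)$ is thickly $n$-sensitive if and only if $\#Q[x]\geq n$ for every $x\in X$.
   Context: Throughout, $G$ is a countable discrete group. A topological dynamical system $(X,G)$ is a (nonempty) compact metric space $X$ with metric $d$ together with a continuous action of $G$ on $X$, written $(g,x)\mapsto gx$. For $n\in\mathbb{N}$, $G$ acts diagonally on $X^n$ by $g(x_1,\dots,x_n)=(gx_1,\dots,gx_n)$. A subsystem is a nonempty closed $G$-invariant subset with the restricted action; a system is minimal if it contains no proper subsystem. A point is a minimal point if it belongs to some minimal subsystem; minimal points of $X\times X$ are taken with respect to the diagonal action. A pair $(x_1,x_2)\in X\times X$ is regionally proximal if for each $\varepsilon>0$ there exist $x_1',x_2'\in X$ with $d(x_i,x_i')<\varepsilon$ for $i=1,2$ and $g\in G$ such that $d(gx_1',gx_2')<\varepsilon$. $Q(X,G)$ is the set of all regionally proximal pairs, and $Q[x]=\{y\in X:(x,y)\in Q(X,G)\}$. $\#(\cdot)$ denotes cardinality. A subset $A$ of $G$ is thick if for any finite subset $F$ of $G$ there exists $g\in G$ such that $Fg\subset A$. For $n\geq 2$, $(X,G)$ is thickly $n$-sensitive if there is a constant $\delta>0$ such that for every nonempty open subset $U$ of $X$ the set $N(U,\delta;n)=\{g\in G:\exists x_1,\dots,x_n\in U\text{ such that }\min_{1\le i<j\le n}d(gx_i,gx_j)>\delta\}$ is thick. *)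

theory Defs
  imports "HOL-Algebra.Group_Action" "HOL-Analysis.Analysis"
begin

text \<open>
  The phase space is a compact subset \<open>X\<close> of a metric type, carrying the subspace topology
  and the metric \<^const>\<open>dist\<close>. The action is a homomorphism from \<open>G\<close> into \<open>BijGroup X\<close>
  (\<^const>\<open>group_action\<close>), so each \<open>\<phi> g\<close> is extensional on \<open>X\<close>. As \<open>G\<close> is discrete, continuity of
  the action is continuity of each \<open>\<phi> g\<close>.
\<close>

locale dynamical_system = group_action G X \<phi>
  for G :: "('g, 'b) monoid_scheme" (structure)
    and X :: "'a::metric_space set" and \<phi> +
  assumes countable_group: "countable (carrier G)"
    and nonempty_space: "X \<noteq> {}"
    and compact_space: "compact X"
    and continuous_action: "\<And>g. g \<in> carrier G \<Longrightarrow> continuous_on X (\<phi> g)"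

definition subsystem ::
    "('g, 'b) monoid_scheme \<Rightarrow> 'a::metric_space set \<Rightarrow> ('g \<Rightarrow> 'a \<Rightarrow> 'a) \<Rightarrow> 'a set \<Rightarrow> bool" where
  "subsystem G X \<phi> A \<longleftrightarrow>
     A \<noteq> {} \<and> closedin (top_of_set X) A \<and> (\<forall>g\<in>carrier G. \<phi> g ` A \<subseteq> A)"

definition restricted_action :: "('g \<Rightarrow> 'a \<Rightarrow> 'a) \<Rightarrow> 'a set \<Rightarrow> 'g \<Rightarrow> 'a \<Rightarrow> 'a" where
  "restricted_action \<phi> A = (\<lambda>g. restrict (\<phi> g) A)"

definition minimal_system ::
    "('g, 'b) monoid_scheme \<Rightarrow> 'a::metric_space set \<Rightarrow> ('g \<Rightarrow> 'a \<Rightarrow> 'a) \<Rightarrow> bool" where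
  "minimal_system G X \<phi> \<longleftrightarrow>
     dynamical_system G X \<phi> \<and> \<not> (\<exists>A. subsystem G X \<phi> A \<and> A \<subset> X)"

definition minimal_point ::
    "('g, 'b) monoid_scheme \<Rightarrow> 'a::metric_space set \<Rightarrow> ('g \<Rightarrow> 'a \<Rightarrow> 'a) \<Rightarrow> 'a \<Rightarrow> bool" where
  "minimal_point G X \<phi> x \<longleftrightarrow>
     (\<exists>A. subsystem G X \<phi> A \<and> minimal_system G A (restricted_action \<phi> A) \<and> x \<in> A)"

definition diagonal_action :: "'a set \<Rightarrow> ('g \<Rightarrow> 'a \<Rightarrow> 'a) \<Rightarrow> 'g \<Rightarrow> 'a \<times> 'a \<Rightarrow> 'a \<times> 'a" where
  "diagonal_action X \<phi> = (\<lambda>g. \<lambda>(x, y)\<in>X \<times> X. (\<phi> g x, \<phi> g y))"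

definition regionally_proximal ::
    "('g, 'b) monoid_scheme \<Rightarrow> 'a::metric_space set \<Rightarrow> ('g \<Rightarrow> 'a \<Rightarrow> 'a) \<Rightarrow> ('a \<times> 'a) set" where
  "regionally_proximal G X \<phi> =
     {(x\<^sub>1, x\<^sub>2) \<in> X \<times> X. \<forall>\<epsilon>>0. \<exists>x\<^sub>1'\<in>X. \<exists>x\<^sub>2'\<in>X. \<exists>g\<in>carrier G.
        dist x\<^sub>1 x\<^sub>1' < \<epsilon> \<and> dist x\<^sub>2 x\<^sub>2' < \<epsilon> \<and> dist (\<phi> g x\<^sub>1') (\<phi> g x\<^sub>2') < \<epsilon>}"

definition thick :: "('g, 'b) monoid_scheme \<Rightarrow> 'g set \<Rightarrow> bool" where
  "thick G A \<longleftrightarrow> A \<subseteq> carrier G \<and>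
     (\<forall>F. finite F \<and> F \<subseteq> carrier G \<longrightarrow> (\<exists>g\<in>carrier G. F #>\<^bsub>G\<^esub> g \<subseteq> A))"

definition separation_times ::
    "('g, 'b) monoid_scheme \<Rightarrow> ('g \<Rightarrow> 'a::metric_space \<Rightarrow> 'a) \<Rightarrow> 'a set \<Rightarrow> real \<Rightarrow> nat \<Rightarrow> 'g set" where
  "separation_times G \<phi> U \<delta> n =
     {g \<in> carrier G. \<exists>x :: nat \<Rightarrow> 'a. (\<forall>i\<in>{1..n}. x i \<in> U) \<and>
        (\<forall>i j. 1 \<le> i \<and> i < j \<and> j \<le> n \<longrightarrow> dist (\<phi> g (x i)) (\<phi> g (x j)) > \<delta>)}"

definition thickly_sensitive ::
    "('g, 'b) monoid_scheme \<Rightarrow> 'a::metric_space set \<Rightarrow> ('g \<Rightarrow> 'a \<Rightarrow> 'a) \<Rightarrow> nat \<Rightarrow> bool" where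
  "thickly_sensitive G X \<phi> n \<longleftrightarrow>
     (\<exists>\<delta>>0. \<forall>U. openin (top_of_set X) U \<and> U \<noteq> {} \<longrightarrow> thick G (separation_times G \<phi> U \<delta> n))"

lemma (in dynamical_system) dynamical_system_transfer:
  fixes Y :: "'c::metric_space set"
  assumes "Y \<noteq> {}" "compact Y"
    and ext: "\<And>g. g \<in> carrier G \<Longrightarrow> \<psi> g \<in> extensional Y"
    and maps: "\<And>g y. g \<in> carrier G \<Longrightarrow> y \<in> Y \<Longrightarrow> \<psi> g y \<in> Y"
    and one: "\<And>y. y \<in> Y \<Longrightarrow> \<psi> \<one> y = y"
    and mult: "\<And>g h y. g \<in> carrier G \<Longrightarrow> h \<in> carrier G \<Longrightarrow> y \<in> Y \<Longrightarrow> \<psi> (g \<otimes> h) y = \<psi> g (\<psi> h y)"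
    and cont: "\<And>g. g \<in> carrier G \<Longrightarrow> continuous_on Y (\<psi> g)"
  shows "dynamical_system G Y \<psi>"
proof -
  interpret G: group G by (rule group_hom.axioms(1)[OF group_hom])
  have bij: "\<psi> g \<in> Bij Y" if g: "g \<in> carrier G" for g
  proof -
    have "bij_betw (\<psi> g) Y Y"
    proof (rule bij_betw_byWitness[where f' = "\<psi> (inv g)"])
      show "\<forall>y\<in>Y. \<psi> (inv g) (\<psi> g y) = y"
        using mult[of "inv g" g] one g by simp
      show "\<forall>y\<in>Y. \<psi> g (\<psi> (inv g) y) = y"
        using mult[of g "inv g"] one g by simp
    qed (use maps g in auto)
    then show ?thesis using ext[OF g] by (simp add: Bij_def)
  qed
  have "group_action G Y \<psi>"
    unfolding group_action_def group_hom_def group_hom_axioms_def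
  proof (intro conjI)
    show "\<psi> \<in> hom G (BijGroup Y)"
    proof (rule homI)
      show "\<psi> g \<in> carrier (BijGroup Y)" if "g \<in> carrier G" for g
        using bij[OF that] by (simp add: BijGroup_def)
      show "\<psi> (g \<otimes> h) = \<psi> g \<otimes>\<^bsub>BijGroup Y\<^esub> \<psi> h" if gh: "g \<in> carrier G" "h \<in> carrier G" for g h
      proof -
        have "\<psi> (g \<otimes> h) = compose Y (\<psi> g) (\<psi> h)"
          by (rule extensionalityI[of _ Y])
             (use gh ext mult in \<open>auto simp: compose_def\<close>)
        then show ?thesis using bij gh by (simp add: BijGroup_def)
      qed
    qed
  qed (auto intro: group_BijGroup G.group_axioms)
  then show ?thesis
    using assms countable_group by (simp add: dynamical_system_def dynamical_system_axioms_def)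
qed

lemma (in dynamical_system) action_mult:
  assumes "g \<in> carrier G" "h \<in> carrier G" "x \<in> X"
  shows "\<phi> (g \<otimes> h) x = \<phi> g (\<phi> h x)"
  using composition_rule[OF assms(3,1,2)] .

lemma (in dynamical_system) dynamical_system_subsystem:
  assumes "subsystem G X \<phi> A"
  shows "dynamical_system G A (restricted_action \<phi> A)"
proof -
  interpret G: group G by (rule group_hom.axioms(1)[OF group_hom])
  have A: "A \<noteq> {}" "closedin (top_of_set X) A" "\<And>g x. g \<in> carrier G \<Longrightarrow> x \<in> A \<Longrightarrow> \<phi> g x \<in> A"
    using assms by (auto simp: subsystem_def)
  have sub: "A \<subseteq> X" using A(2) closedin_imp_subset by blast
  show ?thesis
  proof (rule dynamical_system_transfer)
    show "compact A" using closedin_compact[OF compact_space A(2)] .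
    show "continuous_on A (restricted_action \<phi> A g)" if "g \<in> carrier G" for g
      using continuous_on_subset[OF continuous_action[OF that] sub]
      by (simp add: restricted_action_def)
  qed (use A sub action_mult id_eq_one in \<open>auto simp: restricted_action_def subset_eq\<close>,
       metis restrict_apply' subsetD)
qed

lemma (in dynamical_system) dynamical_system_diagonal:
  "dynamical_system G (X \<times> X) (diagonal_action X \<phi>)"
proof -
  interpret G: group G by (rule group_hom.axioms(1)[OF group_hom])
  have one: "\<phi> \<one> x = x" if "x \<in> X" for x
    using id_eq_one that by (metis restrict_apply')
  have maps: "\<phi> g x \<in> X" if "g \<in> carrier G" "x \<in> X" for g x
    using element_image that by blast
  show ?thesis
  proof (rule dynamical_system_transfer)
    show "continuous_on (X \<times> X) (diagonal_action X \<phi> g)" if "g \<in> carrier G" for g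
    proof -
      have "continuous_on (X \<times> X) (\<lambda>p. (\<phi> g (fst p), \<phi> g (snd p)))"
        by (intro continuous_on_Pair continuous_on_compose2[OF continuous_action[OF that]]
              continuous_intros) auto
      then show ?thesis
        by (rule continuous_on_eq) (auto simp: diagonal_action_def)
    qed
  qed (use nonempty_space compact_space maps one action_mult in
       \<open>auto simp: diagonal_action_def compact_Times\<close>)
qed

end

theory Submission
  imports Defs
begin

text \<open>
  For necessity, thickness along a finite set of return times to a ball around \<open>x\<close> provides
  \<open>\<delta>\<close>-separated points that are almost regionally proximal to \<open>x\<close>. By compactness each of them is
  close to \<open>Q[x]\<close>, which therefore has at least \<open>n\<close> elements.

  For sufficiency, the Baire category theorem yields a point \<open>x\<close> such that every \<open>y \<in> Q[x]\<close> is
  approximated, for each open \<open>W\<close>, by some \<open>y'\<close> with \<open>(x, y')\<close> a minimal point whose orbit enters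
  \<open>W \<times> W\<close>. The projection of a relatively open part of a minimal subset of \<open>X \<times> X\<close> has nonempty
  interior, and this makes the exceptional sets nowhere dense. For finitely many elements of \<open>Q[x]\<close>
  a single group element is found inductively: a finite set \<open>K\<close> returns the orbit of \<open>(x, y')\<close> to
  \<open>W \<times> W\<close>, and the remaining points are first gathered in a \<open>W'\<close> so small that \<open>K\<close> moves it by
  small sets only. A further genericity condition on \<open>x\<close> makes \<open>z \<mapsto> Q[z]\<close> lower semicontinuous at
  \<open>x\<close> and hence, by minimality, gives \<open>n\<close> uniformly separated points in every \<open>Q[z]\<close>. Gathering the
  points \<open>\<phi> (inv f) p\<close>, for \<open>f \<in> F\<close> and \<open>p\<close> among those chosen in \<open>Q[f x]\<close>, proves thickness.
\<close>

section \<open>Countable bases and Baire category in compact metric spaces\<close>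

lemma openin_contains_ballE:
  fixes X :: "'a::metric_space set"
  assumes "openin (top_of_set X) U" "x \<in> U"
  obtains r where "r > 0" "X \<inter> ball x r \<subseteq> U"
  using assms unfolding openin_contains_ball by (metis Int_commute)

text \<open>Total boundedness gives finite nets at every scale \<open>1 / Suc k\<close>; the balls
  about their centres form the base. It later reduces genericity to countably many
  conditions.\<close>

lemma second_countable_compact:
  fixes X :: "'a::metric_space set"
  assumes "compact X"
  shows "second_countable (top_of_set X)"
proof -
  have "\<exists>C. finite C \<and> C \<subseteq> X \<and> X \<subseteq> (\<Union>c\<in>C. ball c (1 / real (Suc k)))" for k
    using seq_compact_imp_totally_bounded[of X] assms
    by (simp add: compact_eq_seq_compact_metric)
  then obtain C where C: "finite (C k)" "C k \<subseteq> X" "X \<subseteq> (\<Union>c\<in>C k. ball c (1 / real (Suc k)))" for k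
    by metis
  define \<B> where "\<B> = (\<Union>k. (\<lambda>c. X \<inter> ball c (1 / real (Suc k))) ` C k)"
  have "countable \<B>"
    unfolding \<B>_def using C(1) by (intro countable_UN countable_image) (auto intro: countable_finite)
  moreover have "openin (top_of_set X) V" if "V \<in> \<B>" for V
    using that by (auto simp: \<B>_def)
  moreover have "\<exists>V\<in>\<B>. x \<in> V \<and> V \<subseteq> U" if U: "openin (top_of_set X) U" "x \<in> U" for U x
  proof -
    obtain r where r: "r > 0" "X \<inter> ball x r \<subseteq> U"
      using openin_contains_ballE[OF U] .
    have xX: "x \<in> X" using U openin_imp_subset by blast
    obtain k where k: "1 / real (Suc k) < r / 2"
      using r(1) nat_approx_posE[of "r/2"] by auto
    obtain c where c: "c \<in> C k" "dist c x < 1 / real (Suc k)"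
      using C(3)[of k] xX by auto
    have "X \<inter> ball c (1 / real (Suc k)) \<subseteq> U"
    proof
      fix y assume y: "y \<in> X \<inter> ball c (1 / real (Suc k))"
      have "dist x y \<le> dist c x + dist c y" by (metis dist_commute dist_triangle)
      then have "dist x y < r" using y c(2) k by auto
      then show "y \<in> U" using y r(2) by auto
    qed
    then show ?thesis using c xX by (auto simp: \<B>_def intro!: exI[of _ k])
  qed
  ultimately show ?thesis unfolding second_countable_def by blast
qed

lemma compact_imp_locally_compact_regular:
  fixes X :: "'a::metric_space set"
  assumes "compact X"
  shows "locally_compact_space (top_of_set X) \<and> regular_space (top_of_set X)"
proof -
  have "compact_space (top_of_set X)"
    using assms by (simp add: compact_space_subtopology)
  moreover have "Hausdorff_space (top_of_set X)"
    by (simp add: Hausdorff_space_subtopology)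
  ultimately show ?thesis
    by (metis compact_imp_locally_compact_space compact_Hausdorff_imp_regular_space)
qed

text \<open>Baire's theorem read as an existence statement: the intersection is dense, hence
  nonempty because \<open>X\<close> is.\<close>

lemma compact_exists_generic_point:
  fixes X :: "'a::metric_space set"
  assumes X: "compact X" "X \<noteq> {}" and "countable \<D>"
    and D: "\<And>D. D \<in> \<D> \<Longrightarrow> openin (top_of_set X) D"
    and dense: "\<And>D V. D \<in> \<D> \<Longrightarrow> openin (top_of_set X) V \<Longrightarrow> V \<noteq> {} \<Longrightarrow> D \<inter> V \<noteq> {}"
  shows "\<exists>x\<in>X. \<forall>D\<in>\<D>. x \<in> D"
proof -
  have "top_of_set X closure_of D = topspace (top_of_set X)" if "D \<in> \<D>" for D
    using dense[OF that] by (auto simp: closure_of_def) 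
  then have "top_of_set X closure_of \<Inter>\<D> = topspace (top_of_set X)"
    using Baire_category[of "top_of_set X" \<D>] compact_imp_locally_compact_regular[OF X(1)] D \<open>countable \<D>\<close> by blast
  then have "X \<inter> \<Inter>\<D> \<noteq> {}"
    using X(2) closure_of_restrict[of "top_of_set X" "\<Inter>\<D>"] by auto
  then show ?thesis by blast
qed

text \<open>The dual form of Baire's theorem. It is applied to finitely many preimages of one closed
  set, to find interior in a translate of that set.\<close>

lemma compact_countable_closed_cover:
  fixes X :: "'a::metric_space set"
  assumes X: "compact X" "X \<noteq> {}" and "countable \<C>" "X \<subseteq> \<Union>\<C>"
    and C: "\<And>C. C \<in> \<C> \<Longrightarrow> closedin (top_of_set X) C"
  obtains C U where "C \<in> \<C>" "openin (top_of_set X) U" "U \<noteq> {}" "U \<subseteq> C"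
proof -
  have "\<exists>C\<in>\<C>. top_of_set X interior_of C \<noteq> {}"
  proof (rule ccontr)
    assume "\<not> ?thesis"
    then have "top_of_set X interior_of \<Union>\<C> = {}"
      using Baire_category_alt[of "top_of_set X" \<C>] compact_imp_locally_compact_regular[OF X(1)] C \<open>countable \<C>\<close> by blast
    moreover have "\<Union>\<C> = X" using assms(4) C closedin_imp_subset by blast
    ultimately show False using X(2) interior_of_topspace[of "top_of_set X"] by simp
  qed
  then show ?thesis using that by (metis interior_of_subset openin_interior_of)
qed

section \<open>Finite return sets in minimal systems\<close>

text \<open>The points whose orbit never enters \<open>V\<close> form a closed invariant proper
  subset, so by minimality there are none, and compactness leaves finitely many group elements. The
  system is arbitrary because the lemma serves both \<open>X\<close> and the minimal subsets of
  \<open>X \<times> X\<close>.\<close>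

lemma minimal_system_finite_return:
  fixes G (structure)
  assumes "minimal_system G Y \<psi>" "openin (top_of_set Y) V" "V \<noteq> {}"
  obtains K where "finite K" "K \<subseteq> carrier G" "\<And>y. y \<in> Y \<Longrightarrow> \<exists>k\<in>K. \<psi> k y \<in> V"
proof -
  interpret dynamical_system G Y \<psi> using assms(1) by (simp add: minimal_system_def)
  interpret G: group G by (rule group_hom.axioms(1)[OF group_hom])
  have maps: "\<psi> g y \<in> Y" if "g \<in> carrier G" "y \<in> Y" for g y
    using element_image that by blast
  have one: "\<psi> \<one> y = y" if "y \<in> Y" for y
    using id_eq_one that by (metis restrict_apply')
  define W where "W = (\<lambda>g. Y \<inter> \<psi> g -` V)"
  have W: "openin (top_of_set Y) (W g)" if "g \<in> carrier G" for g
    unfolding W_def using continuous_openin_preimage[OF continuous_action[OF that] _ assms(2)] maps that by auto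
  define A where "A = Y - (\<Union>g\<in>carrier G. W g)"
  have clA: "closedin (top_of_set Y) A"
    unfolding A_def using W by (intro closedin_diff) auto
  have inv: "\<psi> g y \<in> A" if g: "g \<in> carrier G" and y: "y \<in> A" for g y
  proof -
    have "\<psi> h (\<psi> g y) \<notin> V" if h: "h \<in> carrier G" for h
      using action_mult[OF h g, of y] G.m_closed[OF h g] y by (auto simp: A_def W_def)
    then show ?thesis using y maps[OF g] by (auto simp: A_def W_def)
  qed
  obtain v where v: "v \<in> V" using assms(3) by blast
  have "v \<in> Y" using v assms(2) openin_imp_subset by blast
  then have "v \<in> W \<one>" using v one by (auto simp: W_def)
  then have "A \<subset> Y" using \<open>v \<in> Y\<close> by (auto simp: A_def)
  then have "\<not> subsystem G Y \<psi> A" using assms(1) by (auto simp: minimal_system_def)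
  then have "A = {}" using clA inv by (auto simp: subsystem_def)
  then have "Y \<subseteq> \<Union>(W ` carrier G)" by (auto simp: A_def)
  then obtain D where D: "D \<subseteq> W ` carrier G" "finite D" "Y \<subseteq> \<Union>D"
    using compact_space W unfolding compact_eq_openin_cover by (metis (no_types, lifting) imageE)
  obtain K where K: "K \<subseteq> carrier G" "finite K" "D = W ` K"
    using finite_subset_image[OF D(2,1)] by blast
  show ?thesis
    by (rule that[of K]) (use K D(3) in \<open>auto simp: W_def\<close>)
qed

section \<open>The action on \<open>X\<close>: continuity, equicontinuity and joint return\<close>

locale minimal_dynamical_system = dynamical_system +
  assumes minimal: "minimal_system G X \<phi>"
begin

sublocale G: group G by (rule group_hom.axioms(1)[OF group_hom])

abbreviation "Q \<equiv> regionally_proximal G X \<phi>"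
abbreviation "XX \<equiv> X \<times> X"
abbreviation "\<phi>\<phi> \<equiv> diagonal_action X \<phi>"

lemma action_closed [simp, intro]: "g \<in> carrier G \<Longrightarrow> x \<in> X \<Longrightarrow> \<phi> g x \<in> X"
  using element_image by blast

lemma action_one [simp]: "x \<in> X \<Longrightarrow> \<phi> \<one> x = x"
  using id_eq_one by (metis restrict_apply')

lemma action_inv [simp]:
  assumes "g \<in> carrier G" "x \<in> X"
  shows "\<phi> (inv g) (\<phi> g x) = x" "\<phi> g (\<phi> (inv g) x) = x"
  using action_mult[of "inv g" g x] action_mult[of g "inv g" x] assms by auto

lemma openin_preimage:
  assumes "g \<in> carrier G" "openin (top_of_set X) U"
  shows "openin (top_of_set X) {x \<in> X. \<phi> g x \<in> U}"
proof -
  have "openin (top_of_set X) (X \<inter> \<phi> g -` U)"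
    using continuous_openin_preimage[OF continuous_action[OF assms(1)] _ assms(2)] assms(1) by auto
  then show ?thesis by (simp add: vimage_def Int_def)
qed

lemma closedin_preimage:
  assumes "g \<in> carrier G" "closedin (top_of_set X) C"
  shows "closedin (top_of_set X) {x \<in> X. \<phi> g x \<in> C}"
proof -
  have "openin (top_of_set X) {x \<in> X. \<phi> g x \<in> X - C}"
    using assms by (intro openin_preimage) auto
  moreover have "{x \<in> X. \<phi> g x \<in> C} = X - {x \<in> X. \<phi> g x \<in> X - C}"
    using assms(1) by auto
  ultimately show ?thesis by (metis closedin_diff closedin_topspace topspace_euclidean_subtopology)
qed

lemma action_uniformly_continuous:
  assumes "g \<in> carrier G" "\<epsilon> > 0"
  obtains \<eta> where "\<eta> > 0"
    "\<And>x y. x \<in> X \<Longrightarrow> y \<in> X \<Longrightarrow> dist x y < \<eta> \<Longrightarrow> dist (\<phi> g x) (\<phi> g y) < \<epsilon>"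
proof -
  have "uniformly_continuous_on X (\<phi> g)"
    using assms(1) continuous_action compact_space by (auto intro: compact_uniformly_continuous)
  then show ?thesis
    using that assms(2) unfolding uniformly_continuous_on_def by (metis dist_commute)
qed

text \<open>The whole action need not be equicontinuous, but finite parts of it are. Later estimates
  use this for finite return sets and for the finite set in the definition of thickness.\<close>

lemma finite_action_equicontinuous:
  assumes "finite K" "K \<subseteq> carrier G" "\<epsilon> > 0"
  obtains \<eta> where "\<eta> > 0"
    "\<And>k x y. k \<in> K \<Longrightarrow> x \<in> X \<Longrightarrow> y \<in> X \<Longrightarrow> dist x y < \<eta> \<Longrightarrow> dist (\<phi> k x) (\<phi> k y) < \<epsilon>"
  using assms
proof (induction K arbitrary: thesis rule: finite_induct)
  case empty
  show ?case by (rule empty(1)[of 1]) auto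
next
  case (insert k K)
  obtain \<eta>1 where \<eta>1: "\<eta>1 > 0"
    "\<And>k x y. k \<in> K \<Longrightarrow> x \<in> X \<Longrightarrow> y \<in> X \<Longrightarrow> dist x y < \<eta>1 \<Longrightarrow> dist (\<phi> k x) (\<phi> k y) < \<epsilon>"
    using insert.IH insert.prems by blast
  obtain \<eta>2 where \<eta>2: "\<eta>2 > 0"
    "\<And>x y. x \<in> X \<Longrightarrow> y \<in> X \<Longrightarrow> dist x y < \<eta>2 \<Longrightarrow> dist (\<phi> k x) (\<phi> k y) < \<epsilon>"
    using action_uniformly_continuous[of k \<epsilon>] insert.prems(2,3) by blast
  show ?case
    by (rule insert.prems(1)[of "min \<eta>1 \<eta>2"]) (use \<eta>1 \<eta>2 in auto)
qed

lemmas finite_return = minimal_system_finite_return[OF minimal]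

lemma openin_ball: "openin (top_of_set X) (X \<inter> ball c r)"
  by auto

text \<open>A finite set of return times sends \<open>a\<close> into a half ball, and its
  equicontinuity keeps \<open>b\<close> in the full ball. Closeness of two images of a regionally
  proximal pair can thus be traded for a joint visit to a prescribed open set.\<close>

lemma close_points_return:
  assumes "openin (top_of_set X) W" "W \<noteq> {}"
  obtains \<epsilon> where "\<epsilon> > 0"
    "\<And>a b. a \<in> X \<Longrightarrow> b \<in> X \<Longrightarrow> dist a b < \<epsilon> \<Longrightarrow> \<exists>g\<in>carrier G. \<phi> g a \<in> W \<and> \<phi> g b \<in> W"
proof -
  obtain c where c: "c \<in> W" using assms by blast
  obtain r where r: "r > 0" "X \<inter> ball c r \<subseteq> W"
    using openin_contains_ballE[OF assms(1) c] .
  have cX: "c \<in> X" using c assms openin_imp_subset by blast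
  obtain K where K: "finite K" "K \<subseteq> carrier G" "\<And>y. y \<in> X \<Longrightarrow> \<exists>k\<in>K. \<phi> k y \<in> X \<inter> ball c (r/2)"
    using finite_return[OF openin_ball, of c "r/2"] cX r(1) by (metis IntI centre_in_ball empty_iff half_gt_zero)
  obtain \<eta> where \<eta>: "\<eta> > 0"
    "\<And>k x y. k \<in> K \<Longrightarrow> x \<in> X \<Longrightarrow> y \<in> X \<Longrightarrow> dist x y < \<eta> \<Longrightarrow> dist (\<phi> k x) (\<phi> k y) < r / 2"
    using finite_action_equicontinuous[OF K(1,2), of "r/2"] r(1) by auto
  show ?thesis
  proof (rule that[OF \<eta>(1)])
    fix a b assume ab: "a \<in> X" "b \<in> X" "dist a b < \<eta>"
    obtain k where k: "k \<in> K" "\<phi> k a \<in> X \<inter> ball c (r/2)" using K(3) ab by blast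
    have "dist c (\<phi> k b) \<le> dist c (\<phi> k a) + dist (\<phi> k a) (\<phi> k b)" by (rule dist_triangle)
    also have "\<dots> < r" using k(2) \<eta>(2)[OF k(1) ab] by auto
    finally have "\<phi> k b \<in> X \<inter> ball c r" using k(1) K(2) ab(2) by auto
    then have "\<phi> k b \<in> W" using r(2) by blast
    moreover have "\<phi> k a \<in> W" using r k(2) by fastforce
    ultimately show "\<exists>g\<in>carrier G. \<phi> g a \<in> W \<and> \<phi> g b \<in> W" using k(1) K(2) by blast
  qed
qed

section \<open>The regionally proximal relation: invariance and closedness\<close>

lemma Q_iff:
  "(x, y) \<in> Q \<longleftrightarrow> x \<in> X \<and> y \<in> X \<and> (\<forall>\<epsilon>>0. \<exists>x'\<in>X. \<exists>y'\<in>X. \<exists>g\<in>carrier G.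
     dist x x' < \<epsilon> \<and> dist y y' < \<epsilon> \<and> dist (\<phi> g x') (\<phi> g y') < \<epsilon>)"
  unfolding regionally_proximal_def by simp

lemma QD:
  assumes "(x, y) \<in> Q"
  shows "x \<in> X" "y \<in> X"
  using assms by (simp_all add: Q_iff)

lemma Q_invariant:
  assumes "(x, y) \<in> Q" "g \<in> carrier G"
  shows "(\<phi> g x, \<phi> g y) \<in> Q"
  unfolding Q_iff
proof (intro conjI allI impI)
  have xy: "x \<in> X" "y \<in> X" using assms Q_iff by auto
  show "\<phi> g x \<in> X" "\<phi> g y \<in> X" using xy assms by auto
  fix \<epsilon> :: real assume "\<epsilon> > 0"
  obtain \<eta> where \<eta>: "\<eta> > 0"
    "\<And>x y. x \<in> X \<Longrightarrow> y \<in> X \<Longrightarrow> dist x y < \<eta> \<Longrightarrow> dist (\<phi> g x) (\<phi> g y) < \<epsilon>"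
    using action_uniformly_continuous[OF assms(2) \<open>\<epsilon> > 0\<close>] by blast
  have m: "min \<eta> \<epsilon> > 0" using \<eta>(1) \<open>\<epsilon> > 0\<close> by simp
  obtain x' y' h where h: "x' \<in> X" "y' \<in> X" "h \<in> carrier G"
    "dist x x' < min \<eta> \<epsilon>" "dist y y' < min \<eta> \<epsilon>" "dist (\<phi> h x') (\<phi> h y') < min \<eta> \<epsilon>"
    using assms(1) m unfolding Q_iff by blast
  \<comment> \<open>The perturbed points are moved by \<open>g\<close>, so the new time has to undo
    \<open>g\<close> first.\<close>
  have eq: "\<phi> (h \<otimes> inv g) (\<phi> g z) = \<phi> h z" if "z \<in> X" for z
    using that h assms(2) action_mult[of h "inv g" "\<phi> g z"] by simp
  show "\<exists>x'\<in>X. \<exists>y'\<in>X. \<exists>ga\<in>carrier G. dist (\<phi> g x) x' < \<epsilon> \<and> dist (\<phi> g y) y' < \<epsilon>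
      \<and> dist (\<phi> ga x') (\<phi> ga y') < \<epsilon>"
    by (rule bexI[of _ "\<phi> g x'"], rule bexI[of _ "\<phi> g y'"], rule bexI[of _ "h \<otimes> inv g"])
       (use h \<eta>(2) xy assms(2) eq in auto)
qed

lemma closed_Q: "closed Q"
proof -
  have "p \<in> Q" if p: "p \<in> closure Q" for p
  proof -
    obtain x y where [simp]: "p = (x, y)" by (cases p)
    have near: "\<exists>a b. (a, b) \<in> Q \<and> dist x a < e \<and> dist y b < e" if "e > 0" for e
    proof -
      obtain q where q: "q \<in> Q" "dist q p < e" using p \<open>e > 0\<close> closure_approachable by blast
      have "dist (fst q) x \<le> dist q p" "dist (snd q) y \<le> dist q p"
        using dist_fst_le[of q p] dist_snd_le[of q p] by auto
      then show ?thesis using q by (intro exI[of _ "fst q"] exI[of _ "snd q"]) (auto simp: dist_commute)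
    qed
    have "closed (X \<times> X)" using compact_space by (simp add: closed_Times compact_imp_closed)
    moreover have "Q \<subseteq> X \<times> X" using Q_iff by auto
    ultimately have "p \<in> X \<times> X" using p closure_minimal by blast
    moreover have "\<exists>x'\<in>X. \<exists>y'\<in>X. \<exists>g\<in>carrier G. dist x x' < \<epsilon> \<and> dist y y' < \<epsilon> \<and> dist (\<phi> g x') (\<phi> g y') < \<epsilon>"
      if "\<epsilon> > 0" for \<epsilon>
    proof -
      obtain a b where ab: "(a, b) \<in> Q" "dist x a < \<epsilon>/2" "dist y b < \<epsilon>/2"
        using near[of "\<epsilon>/2"] \<open>\<epsilon> > 0\<close> by auto
      obtain x' y' g where g: "x' \<in> X" "y' \<in> X" "g \<in> carrier G"
        "dist a x' < \<epsilon>/2" "dist b y' < \<epsilon>/2" "dist (\<phi> g x') (\<phi> g y') < \<epsilon>/2"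
        using ab(1) \<open>\<epsilon> > 0\<close> unfolding Q_iff by (meson half_gt_zero)
      have "dist x x' < \<epsilon>" "dist y y' < \<epsilon>"
        using ab g dist_triangle[of x x' a] dist_triangle[of y y' b] by linarith+
      moreover have "dist (\<phi> g x') (\<phi> g y') < \<epsilon>" using g(6) \<open>\<epsilon> > 0\<close> by linarith
      ultimately show ?thesis using g by blast
    qed
    ultimately show ?thesis by (auto simp: Q_iff)
  qed
  then show ?thesis by (metis closure_subset closure_eq subsetI subset_antisym)
qed

section \<open>Minimal subsets of \<open>X \<times> X\<close> and their projections\<close>

definition "minimal_pairs M \<longleftrightarrow>
  subsystem G XX \<phi>\<phi> M \<and> minimal_system G M (restricted_action \<phi>\<phi> M)"

lemma minimal_pairsD:
  assumes "minimal_pairs M"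
  shows "M \<noteq> {}" "M \<subseteq> XX" "compact M"
    "\<And>g a b. g \<in> carrier G \<Longrightarrow> (a, b) \<in> M \<Longrightarrow> (\<phi> g a, \<phi> g b) \<in> M"
proof -
  have M: "M \<noteq> {}" "closedin (top_of_set XX) M" "\<And>g p. g \<in> carrier G \<Longrightarrow> p \<in> M \<Longrightarrow> \<phi>\<phi> g p \<in> M"
    using assms by (auto simp: minimal_pairs_def subsystem_def)
  then show "M \<noteq> {}" "M \<subseteq> XX" "compact M"
    using closedin_imp_subset closedin_compact[of XX M] compact_space compact_Times by blast+
  then show "(\<phi> g a, \<phi> g b) \<in> M" if "g \<in> carrier G" "(a, b) \<in> M" for g a b
    using M(3)[OF that] that(2) by (auto simp: diagonal_action_def)
qed

text \<open>Minimality of \<open>M\<close> gives one finite \<open>K\<close> for all pairs of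
  \<open>M\<close>, in particular along the whole orbit of a pair.\<close>

lemma minimal_pairs_return:
  assumes M: "minimal_pairs M" and UV: "openin (top_of_set X) U" "openin (top_of_set X) V"
    and ne: "M \<inter> U \<times> V \<noteq> {}"
  obtains K where "finite K" "K \<subseteq> carrier G"
    "\<And>a b. (a, b) \<in> M \<Longrightarrow> \<exists>k\<in>K. \<phi> k a \<in> U \<and> \<phi> k b \<in> V"
proof -
  have "openin (top_of_set XX) (U \<times> V)" using UV by (rule openin_Times)
  then have op: "openin (top_of_set M) (M \<inter> U \<times> V)"
    using minimal_pairsD(2)[OF M]
    by (metis inf.absorb_iff2 inf_commute openin_subtopology_Int subtopology_subtopology)
  have ms: "minimal_system G M (restricted_action \<phi>\<phi> M)"
    using M by (simp add: minimal_pairs_def)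
  obtain K where K: "finite K" "K \<subseteq> carrier G"
      "\<And>p. p \<in> M \<Longrightarrow> \<exists>k\<in>K. restricted_action \<phi>\<phi> M k p \<in> M \<inter> U \<times> V"
    using minimal_system_finite_return[OF ms op ne] by metis
  have "\<exists>k\<in>K. \<phi> k a \<in> U \<and> \<phi> k b \<in> V" if "(a, b) \<in> M" for a b
  proof -
    have "a \<in> X" "b \<in> X" using that minimal_pairsD(2)[OF M] by auto
    then show ?thesis
      using K(3)[OF that] that by (simp add: restricted_action_def diagonal_action_def) blast
  qed
  then show ?thesis using that K by blast
qed

text \<open>The projection is compact and invariant, hence a subsystem, and minimality of
  \<open>X\<close> leaves no proper one.\<close>

lemma minimal_pairs_fst:
  assumes "minimal_pairs M"
  shows "fst ` M = X"
proof (rule ccontr)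
  note M = minimal_pairsD[OF assms]
  assume "fst ` M \<noteq> X"
  then have "fst ` M \<subset> X" using M(2) by auto
  moreover have "compact (fst ` M)"
    using M(3) by (intro compact_continuous_image continuous_on_fst continuous_on_id)
  ultimately have "closedin (top_of_set X) (fst ` M)"
    by (meson closed_subset compact_imp_closed psubset_imp_subset)
  then have "subsystem G X \<phi> (fst ` M)"
    using M(1,4) by (force simp: subsystem_def)
  then show False using minimal \<open>fst ` M \<subset> X\<close> by (auto simp: minimal_system_def)
qed

text \<open>Finitely many elements return every pair of \<open>M\<close> to a compact piece
  \<open>C\<close>, so finitely many preimages of the projection of \<open>C\<close> cover
  \<open>X\<close>. One of them has interior by Baire, and its group element moves that interior
  into the projection.\<close>

lemma minimal_pairs_projection:
  assumes M: "minimal_pairs M" and UV: "openin (top_of_set X) U" "openin (top_of_set X) V"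
    and ne: "M \<inter> U \<times> V \<noteq> {}"
  obtains S where "openin (top_of_set X) S" "S \<noteq> {}" "S \<subseteq> fst ` (M \<inter> U \<times> V)"
proof -
  obtain a b where ab: "(a, b) \<in> M" "a \<in> U" "b \<in> V" using ne by auto
  obtain r where r: "r > 0" "X \<inter> ball a r \<subseteq> U" using openin_contains_ballE[OF UV(1) ab(2)] .
  obtain s where s: "s > 0" "X \<inter> ball b s \<subseteq> V" using openin_contains_ballE[OF UV(2) ab(3)] .
  \<comment> \<open>Closed balls make the piece compact and its projection closed, while the open
    half balls inside them still allow the return argument.\<close>
  define C where "C = M \<inter> cball a (r/2) \<times> cball b (s/2)"
  have C: "compact C" "C \<subseteq> M \<inter> U \<times> V"
  proof -
    show "compact C"
      unfolding C_def using minimal_pairsD(3)[OF M] by (intro compact_Int_closed closed_Times) auto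
    have "cball a (r/2) \<subseteq> ball a r" "cball b (s/2) \<subseteq> ball b s" using r(1) s(1) by auto
    then show "C \<subseteq> M \<inter> U \<times> V" using r(2) s(2) minimal_pairsD(2)[OF M] by (auto simp: C_def)
  qed
  have "M \<inter> (X \<inter> ball a (r/2)) \<times> (X \<inter> ball b (s/2)) \<noteq> {}"
    using ab r(1) s(1) minimal_pairsD(2)[OF M] by auto
  then obtain K where K: "finite K" "K \<subseteq> carrier G"
    "\<And>a' b'. (a', b') \<in> M \<Longrightarrow> \<exists>k\<in>K. \<phi> k a' \<in> X \<inter> ball a (r/2) \<and> \<phi> k b' \<in> X \<inter> ball b (s/2)"
    using minimal_pairs_return[OF M openin_ball openin_ball] by metis
  have clC: "closedin (top_of_set X) (fst ` C)"
  proof -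
    have "compact (fst ` C)"
      using C(1) by (intro compact_continuous_image continuous_on_fst continuous_on_id)
    moreover have "fst ` C \<subseteq> X" using C(2) minimal_pairsD(2)[OF M] by auto
    ultimately show ?thesis by (meson closed_subset compact_imp_closed)
  qed
  define E where "E = (\<lambda>k. {x \<in> X. \<phi> k x \<in> fst ` C})"
  have "X \<subseteq> \<Union>(E ` K)"
  proof
    fix x assume "x \<in> X"
    then obtain y where xy: "(x, y) \<in> M" using minimal_pairs_fst[OF M] by force
    then obtain k where k: "k \<in> K" "\<phi> k x \<in> ball a (r/2)" "\<phi> k y \<in> ball b (s/2)"
      using K(3) by blast
    have "(\<phi> k x, \<phi> k y) \<in> C"
      using k K(2) minimal_pairsD(4)[OF M _ xy, of k] by (auto simp: C_def less_imp_le)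
    then show "x \<in> \<Union>(E ` K)" using \<open>x \<in> X\<close> k(1) by (force simp: E_def)
  qed
  then obtain k T where k: "k \<in> K" and T: "openin (top_of_set X) T" "T \<noteq> {}" "T \<subseteq> E k"
    using compact_countable_closed_cover[OF compact_space nonempty_space, of "E ` K"]
      closedin_preimage[OF _ clC] K(1,2) unfolding E_def
    by (smt (verit, best) countable_finite finite_imageI imageE subsetD)
  have kG: "k \<in> carrier G" using k K(2) by blast
  show ?thesis
  proof (rule that)
    \<comment> \<open>This set is the image of \<open>T\<close> under \<open>\<phi> k\<close>,
      written as a preimage to obtain openness at once.\<close>
    show "openin (top_of_set X) {x \<in> X. \<phi> (inv k) x \<in> T}"
      using kG T(1) by (intro openin_preimage) auto
    show "{x \<in> X. \<phi> (inv k) x \<in> T} \<noteq> {}"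
    proof -
      obtain t where t: "t \<in> T" "t \<in> X" using T openin_imp_subset by blast
      then show ?thesis using kG by (auto intro!: exI[of _ "\<phi> k t"])
    qed
    show "{x \<in> X. \<phi> (inv k) x \<in> T} \<subseteq> fst ` (M \<inter> U \<times> V)"
    proof
      fix x assume x: "x \<in> {x \<in> X. \<phi> (inv k) x \<in> T}"
      then have "\<phi> k (\<phi> (inv k) x) \<in> fst ` C" using T(3) by (auto simp: E_def)
      then have "x \<in> fst ` C" using x kG by simp
      then show "x \<in> fst ` (M \<inter> U \<times> V)" using C(2) by blast
    qed
  qed
qed

section \<open>Generic points for the sections of \<open>Q\<close>\<close>

text \<open>
  Only points \<open>y\<close> for which \<open>(x, y)\<close> itself lies in a minimal set are admitted: the
  syndetic return times of \<open>(x, y)\<close> are what \<open>finite_Q_section_joined\<close> needs.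
\<close>

definition "joined B W = {x. \<exists>M y g. minimal_pairs M \<and> (x, y) \<in> M \<and> y \<in> B \<and>
  g \<in> carrier G \<and> \<phi> g x \<in> W \<and> \<phi> g y \<in> W}"

definition "Q_meets C = {x \<in> X. \<exists>y\<in>C. (x, y) \<in> Q}"

text \<open>The set is the projection of a compact part of \<open>Q\<close>. Closedness of
  \<open>C\<close> is what makes that part compact, which is why closures of open sets appear
  below.\<close>

lemma closedin_Q_meets:
  assumes "closed C"
  shows "closedin (top_of_set X) (Q_meets C)"
proof -
  have "compact (X \<times> X \<inter> (Q \<inter> UNIV \<times> C))"
    using compact_space closed_Q assms
    by (intro compact_Int_closed compact_Times closed_Int closed_Times) auto
  then have "compact (fst ` (X \<times> X \<inter> (Q \<inter> UNIV \<times> C)))"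
    by (intro compact_continuous_image continuous_on_fst continuous_on_id)
  moreover have "fst ` (X \<times> X \<inter> (Q \<inter> UNIV \<times> C)) = Q_meets C"
  proof (intro equalityI subsetI)
    fix x assume "x \<in> Q_meets C"
    then obtain y where y: "y \<in> C" "(x, y) \<in> Q" by (auto simp: Q_meets_def)
    then have "(x, y) \<in> X \<times> X \<inter> (Q \<inter> UNIV \<times> C)" using QD[OF y(2)] by simp
    then show "x \<in> fst ` (X \<times> X \<inter> (Q \<inter> UNIV \<times> C))" by (rule rev_image_eqI) simp
  qed (auto simp: Q_meets_def)
  ultimately have "closed (Q_meets C)" by (simp add: compact_imp_closed)
  then show ?thesis by (intro closed_subset) (auto simp: Q_meets_def)
qed

text \<open>Both clauses range over all open sets, although category imposes them on basic sets. The
  second is lower semicontinuity at \<open>x\<close> of the sections of \<open>Q\<close>; its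
  closure is harmless, since \<open>B\<close> may be taken as a small ball.\<close>

definition "generic x \<longleftrightarrow> x \<in> X \<and>
  (\<forall>y B W. (x, y) \<in> Q \<longrightarrow> openin (top_of_set X) B \<longrightarrow> y \<in> B \<longrightarrow>
     openin (top_of_set X) W \<longrightarrow> W \<noteq> {} \<longrightarrow> x \<in> joined B W) \<and>
  (\<forall>y B. (x, y) \<in> Q \<longrightarrow> openin (top_of_set X) B \<longrightarrow> y \<in> B \<longrightarrow>
     (\<exists>V. openin (top_of_set X) V \<and> x \<in> V \<and> V \<subseteq> Q_meets (closure B)))"

lemma generic_joined:
  assumes "generic x" "(x, y) \<in> Q" "openin (top_of_set X) B" "y \<in> B"
    "openin (top_of_set X) W" "W \<noteq> {}"
  shows "x \<in> joined B W"
  using assms unfolding generic_def by blast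

lemma generic_Q_meets:
  assumes "generic x" "(x, y) \<in> Q" "openin (top_of_set X) B" "y \<in> B"
  shows "\<exists>V. openin (top_of_set X) V \<and> x \<in> V \<and> V \<subseteq> Q_meets (closure B)"
  using assms unfolding generic_def by blast

text \<open>Only countably many basic sets matter, so Baire applies once each exceptional set is
  nowhere dense. The density hypothesis enters in the first clause, through
  \<open>minimal_pairs_projection\<close>.\<close>

lemma generic_point_exists:
  assumes dense: "\<And>U V. openin (top_of_set X) U \<Longrightarrow> openin (top_of_set X) V \<Longrightarrow> U \<noteq> {} \<Longrightarrow> V \<noteq> {}
      \<Longrightarrow> \<exists>M. minimal_pairs M \<and> M \<inter> U \<times> V \<noteq> {}"
  shows "\<exists>x. generic x"
proof -
  obtain \<B> where "countable \<B> \<and> (\<forall>V\<in>\<B>. openin (top_of_set X) V) \<and>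
      (\<forall>U x. openin (top_of_set X) U \<and> x \<in> U \<longrightarrow> (\<exists>V\<in>\<B>. x \<in> V \<and> V \<subseteq> U))"
    using second_countable_compact[OF compact_space] unfolding second_countable_def ..
  then have \<B>: "countable \<B>" "\<And>V. V \<in> \<B> \<Longrightarrow> openin (top_of_set X) V"
    "\<And>U x. openin (top_of_set X) U \<Longrightarrow> x \<in> U \<Longrightarrow> \<exists>V\<in>\<B>. x \<in> V \<and> V \<subseteq> U"
    by blast+
  \<comment> \<open>\<open>P\<close> is \<open>joined\<close> without minimality. Regional
    proximality puts \<open>x\<close> in the closure of \<open>P\<close>, while every open set
    meeting \<open>P\<close> contains a nonempty open part of \<open>joined\<close>.\<close>
  define P where "P = (\<lambda>B W. {x \<in> X. \<exists>y\<in>B. \<exists>g\<in>carrier G. \<phi> g x \<in> W \<and> \<phi> g y \<in> W})"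
  define core where "core = (\<lambda>A. \<Union>{S. openin (top_of_set X) S \<and> S \<subseteq> A})"
  define D1 where "D1 = (\<lambda>(B, W). core (joined B W) \<union> (X - closure (P B W)))"
  \<comment> \<open>What is left out is the boundary of a closed set, so \<open>D2\<close> is open
    and dense.\<close>
  define D2 where "D2 = (\<lambda>B. core (Q_meets (closure B)) \<union> (X - Q_meets (closure B)))"
  have open_core: "openin (top_of_set X) (core A)" for A
    unfolding core_def by (rule openin_Union) auto
  have oD1: "openin (top_of_set X) (D1 p)" for p
  proof -
    have "openin (top_of_set X) (X - closure A)" for A
      by (metis Diff_eq closed_closure open_Compl openin_open_Int)
    then show ?thesis unfolding D1_def using open_core by (auto simp: case_prod_beta)
  qed
  have oD2: "openin (top_of_set X) (D2 B)" for B
    unfolding D2_def using open_core closedin_Q_meets[OF closed_closure] by (simp add: closedin_def openin_Un)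
  have dense1: "D1 (B, W) \<inter> V \<noteq> {}"
    if BW: "B \<in> \<B>" "W \<in> \<B>" and V: "openin (top_of_set X) V" "V \<noteq> {}" for B W V
  proof (cases "V \<inter> P B W = {}")
    case True
    obtain T where T: "open T" "V = X \<inter> T" using V(1) by (auto simp: openin_open)
    then have "T \<inter> P B W = {}" using True by (auto simp: P_def)
    then have "T \<inter> closure (P B W) = {}" using T(1) by (simp add: open_Int_closure_eq_empty)
    then show ?thesis using T V(2) by (auto simp: D1_def)
  next
    case False
    then obtain x y g where x: "x \<in> V" "x \<in> X" "y \<in> B" "g \<in> carrier G" "\<phi> g x \<in> W" "\<phi> g y \<in> W"
      by (auto simp: P_def)
    have yX: "y \<in> X" using x(3) \<B>(2)[OF BW(1)] openin_imp_subset by blast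
    \<comment> \<open>On \<open>U1 \<times> U2\<close> the same \<open>g\<close> sends both
      coordinates into \<open>W\<close>, so every minimal pair found there is a witness for
      \<open>joined\<close>.\<close>
    define U1 where "U1 = V \<inter> {x \<in> X. \<phi> g x \<in> W}"
    define U2 where "U2 = B \<inter> {x \<in> X. \<phi> g x \<in> W}"
    have U: "openin (top_of_set X) U1" "openin (top_of_set X) U2" "U1 \<noteq> {}" "U2 \<noteq> {}"
      using V(1) \<B>(2) BW x yX openin_preimage[OF x(4)] by (auto simp: U1_def U2_def)
    obtain M where M: "minimal_pairs M" "M \<inter> U1 \<times> U2 \<noteq> {}" using dense[OF U] by blast
    obtain S where S: "openin (top_of_set X) S" "S \<noteq> {}" "S \<subseteq> fst ` (M \<inter> U1 \<times> U2)"
      using minimal_pairs_projection[OF M(1) U(1,2) M(2)] .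
    have "S \<subseteq> joined B W"
    proof
      fix a assume "a \<in> S"
      then obtain b where "(a, b) \<in> M" "a \<in> U1" "b \<in> U2" using S(3) by auto
      then show "a \<in> joined B W" using M(1) x(4) by (auto simp: joined_def U1_def U2_def)
    qed
    then have "S \<subseteq> core (joined B W)" using S(1) by (auto simp: core_def)
    moreover have "S \<subseteq> V" using S(3) by (auto simp: U1_def)
    ultimately show ?thesis using S(2) by (auto simp: D1_def)
  qed
  have dense2: "D2 B \<inter> V \<noteq> {}" if V: "openin (top_of_set X) V" "V \<noteq> {}" for B V
  proof (cases "V \<subseteq> Q_meets (closure B)")
    case True
    then have "V \<subseteq> core (Q_meets (closure B))" using V(1) by (auto simp: core_def)
    then show ?thesis using V(2) by (auto simp: D2_def)
  next
    case False
    then show ?thesis using openin_imp_subset[OF V(1)] by (auto simp: D2_def)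
  qed
  have "\<exists>x\<in>X. \<forall>D \<in> D1 ` (\<B> \<times> \<B>) \<union> D2 ` \<B>. x \<in> D"
  proof (rule compact_exists_generic_point[OF compact_space nonempty_space])
    show "countable (D1 ` (\<B> \<times> \<B>) \<union> D2 ` \<B>)" using \<B>(1) by auto
    show "openin (top_of_set X) D" if "D \<in> D1 ` (\<B> \<times> \<B>) \<union> D2 ` \<B>" for D
      using that oD1 oD2 by blast
    show "D \<inter> V \<noteq> {}"
      if "D \<in> D1 ` (\<B> \<times> \<B>) \<union> D2 ` \<B>" "openin (top_of_set X) V" "V \<noteq> {}" for D V
      using that dense1 dense2 by blast
  qed
  then obtain x where xX: "x \<in> X" and x: "\<forall>D \<in> D1 ` (\<B> \<times> \<B>) \<union> D2 ` \<B>. x \<in> D" ..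
  show ?thesis
    unfolding generic_def
  proof (intro exI[of _ x] conjI allI impI xX)
    fix y B W assume xy: "(x, y) \<in> Q" and B: "openin (top_of_set X) B" "y \<in> B"
      and W: "openin (top_of_set X) W" "W \<noteq> {}"
    obtain B' where B': "B' \<in> \<B>" "y \<in> B'" "B' \<subseteq> B" using \<B>(3)[OF B] by blast
    obtain w where "w \<in> W" using W(2) by blast
    then obtain W' where W': "W' \<in> \<B>" "W' \<noteq> {}" "W' \<subseteq> W" using \<B>(3)[OF W(1)] by blast
    obtain r where r: "r > 0" "X \<inter> ball y r \<subseteq> B'"
      using openin_contains_ballE[OF \<B>(2)[OF B'(1)] B'(2)] .
    \<comment> \<open>Two images under \<open>g\<close> closer than \<open>e\<close> are carried
      jointly into \<open>W'\<close> by some \<open>h\<close>; then \<open>h \<otimes> g\<close>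
      witnesses membership in \<open>P\<close>.\<close>
    obtain e where e: "e > 0"
      "\<And>a b. a \<in> X \<Longrightarrow> b \<in> X \<Longrightarrow> dist a b < e \<Longrightarrow> \<exists>g\<in>carrier G. \<phi> g a \<in> W' \<and> \<phi> g b \<in> W'"
      using close_points_return[OF \<B>(2)[OF W'(1)] W'(2)] by metis
    have "x \<in> closure (P B' W')"
      unfolding closure_approachable
    proof (intro allI impI)
      fix s :: real assume "s > 0"
      define m where "m = min s (min r e)"
      have "m > 0" using \<open>s > 0\<close> r(1) e(1) by (simp add: m_def)
      then obtain x' y' g where g: "x' \<in> X" "y' \<in> X" "g \<in> carrier G"
        "dist x x' < m" "dist y y' < m" "dist (\<phi> g x') (\<phi> g y') < m"
        using xy unfolding Q_iff by blast
      obtain h where h: "h \<in> carrier G" "\<phi> h (\<phi> g x') \<in> W'" "\<phi> h (\<phi> g y') \<in> W'"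
        using e(2)[of "\<phi> g x'" "\<phi> g y'"] g by (auto simp: m_def)
      have "y' \<in> B'" using g r(2) by (auto simp: m_def)
      moreover have "\<phi> (h \<otimes> g) x' \<in> W'" "\<phi> (h \<otimes> g) y' \<in> W'"
        using h g action_mult by auto
      ultimately have "x' \<in> P B' W'" using g(1,3) h(1) unfolding P_def by blast
      then show "\<exists>y\<in>P B' W'. dist y x < s" using g(4) by (auto simp: m_def dist_commute)
    qed
    \<comment> \<open>As \<open>x\<close> lies in the closure of \<open>P\<close>, the other
      alternative of \<open>D1\<close> must hold.\<close>
    moreover have "x \<in> D1 (B', W')" using x B'(1) W'(1) by blast
    ultimately have "x \<in> joined B' W'" by (auto simp: D1_def core_def)
    then show "x \<in> joined B W" using B'(3) W'(3) by (fastforce simp: joined_def)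
  next
    fix y B assume xy: "(x, y) \<in> Q" and B: "openin (top_of_set X) B" "y \<in> B"
    obtain B' where B': "B' \<in> \<B>" "y \<in> B'" "B' \<subseteq> B" using \<B>(3)[OF B] by blast
    have "x \<in> Q_meets (closure B')"
      using xy xX B'(2) closure_subset[of B'] by (auto simp: Q_meets_def)
    moreover have "x \<in> D2 B'" using x B'(1) by blast
    ultimately have "x \<in> core (Q_meets (closure B'))" by (auto simp: D2_def)
    then obtain V where "openin (top_of_set X) V" "x \<in> V" "V \<subseteq> Q_meets (closure B')"
      by (auto simp: core_def)
    moreover have "Q_meets (closure B') \<subseteq> Q_meets (closure B)"
      using closure_mono[OF B'(3)] by (auto simp: Q_meets_def)
    ultimately show "\<exists>V. openin (top_of_set X) V \<and> x \<in> V \<and> V \<subseteq> Q_meets (closure B)"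
      by blast
  qed
qed

section \<open>Sufficiency: gathering and separating points of the sections\<close>

text \<open>The induction keeps \<open>W\<close> arbitrary because its step calls the hypothesis
  with a smaller target. The point \<open>x\<close> is moved exactly while the others may be
  perturbed: it is linked to the new point by a minimal pair and to the old ones by
  closeness.\<close>

lemma finite_Q_section_joined:
  assumes x: "generic x" and "\<epsilon> > 0"
    and "finite Y" "\<And>y. y \<in> Y \<Longrightarrow> (x, y) \<in> Q" "openin (top_of_set X) W" "W \<noteq> {}"
  shows "\<exists>g\<in>carrier G. \<phi> g x \<in> W \<and> (\<forall>y\<in>Y. \<exists>y'\<in>X. dist y y' < \<epsilon> \<and> \<phi> g y' \<in> W)"
proof -
  have xX: "x \<in> X" using x by (simp add: generic_def)
  from assms(3-) show ?thesis
  proof (induction Y arbitrary: W rule: finite_induct)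
    case empty
    obtain K where "K \<subseteq> carrier G" "\<And>y. y \<in> X \<Longrightarrow> \<exists>k\<in>K. \<phi> k y \<in> W"
      using finite_return[OF empty(2,3)] by metis
    then show ?case using xX by blast
  next
    case (insert y Y)
    obtain c where c: "c \<in> W" using insert.prems(3) by blast
    obtain r where r: "r > 0" "X \<inter> ball c r \<subseteq> W"
      using openin_contains_ballE[OF insert.prems(2) c] .
    have cX: "c \<in> X" using c insert.prems(2) openin_imp_subset by blast
    have xy: "(x, y) \<in> Q" using insert.prems(1) by simp
    \<comment> \<open>Genericity replaces \<open>y\<close> by a nearby \<open>y0\<close> for which
      \<open>(x, y0)\<close> lies in a minimal set.\<close>
    then have "x \<in> joined (X \<inter> ball y \<epsilon>) (X \<inter> ball c (r/2))"
      using \<open>\<epsilon> > 0\<close> r(1) cX QD(2)[OF xy] by (intro generic_joined[OF x xy openin_ball _ openin_ball]) auto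
    then obtain M y0 g0 where M: "minimal_pairs M" "(x, y0) \<in> M" "y0 \<in> X \<inter> ball y \<epsilon>" "g0 \<in> carrier G"
        "\<phi> g0 x \<in> X \<inter> ball c (r/2)" "\<phi> g0 y0 \<in> X \<inter> ball c (r/2)"
      unfolding joined_def by blast
    have "M \<inter> (X \<inter> ball c (r/2)) \<times> (X \<inter> ball c (r/2)) \<noteq> {}"
      using minimal_pairsD(4)[OF M(1,4,2)] M(5,6) by blast
    then obtain K where K: "finite K" "K \<subseteq> carrier G"
      "\<And>a b. (a, b) \<in> M \<Longrightarrow> \<exists>k\<in>K. \<phi> k a \<in> X \<inter> ball c (r/2) \<and> \<phi> k b \<in> X \<inter> ball c (r/2)"
      using minimal_pairs_return[OF M(1) openin_ball openin_ball] by metis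
    obtain \<eta> where \<eta>: "\<eta> > 0"
      "\<And>k a b. k \<in> K \<Longrightarrow> a \<in> X \<Longrightarrow> b \<in> X \<Longrightarrow> dist a b < \<eta> \<Longrightarrow> dist (\<phi> k a) (\<phi> k b) < r / 2"
      using finite_action_equicontinuous[OF K(1,2), of "r/2"] r(1) by (metis half_gt_zero)
    \<comment> \<open>Any two points of \<open>W'\<close> are closer than \<open>\<eta>\<close>, so
      each \<open>k\<close> in \<open>K\<close> keeps their images within
      \<open>r/2\<close>.\<close>
    define W' where "W' = X \<inter> ball c (\<eta>/2)"
    have "\<exists>g\<in>carrier G. \<phi> g x \<in> W' \<and> (\<forall>z\<in>Y. \<exists>z'\<in>X. dist z z' < \<epsilon> \<and> \<phi> g z' \<in> W')"
    proof (rule insert.IH)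
      show "(x, z) \<in> Q" if "z \<in> Y" for z using insert.prems(1) that by simp
      show "openin (top_of_set X) W'" unfolding W'_def by (rule openin_ball)
      show "W' \<noteq> {}" using cX \<eta>(1) by (auto simp: W'_def)
    qed
    then obtain g where g: "g \<in> carrier G" "\<phi> g x \<in> W'"
      "\<forall>z\<in>Y. \<exists>z'\<in>X. dist z z' < \<epsilon> \<and> \<phi> g z' \<in> W'"
      by blast
    \<comment> \<open>\<open>K\<close> was fixed before \<open>g\<close>; it applies because the
      image of \<open>(x, y0)\<close> under \<open>g\<close> is still in \<open>M\<close>.\<close>
    obtain k where k: "k \<in> K" "\<phi> k (\<phi> g x) \<in> X \<inter> ball c (r/2)" "\<phi> k (\<phi> g y0) \<in> X \<inter> ball c (r/2)"
      using K(3)[OF minimal_pairsD(4)[OF M(1) g(1) M(2)]] by blast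
    have kG: "k \<in> carrier G" using k(1) K(2) by blast
    have mult: "\<phi> (k \<otimes> g) z = \<phi> k (\<phi> g z)" if "z \<in> X" for z
      using action_mult[OF kG g(1) that] .
    have half: "X \<inter> ball c (r/2) \<subseteq> W" using r subset_ball[of "r/2" r c] by auto
    show ?case
    proof (intro bexI[of _ "k \<otimes> g"] conjI ballI)
      show "k \<otimes> g \<in> carrier G" using kG g(1) by blast
      show "\<phi> (k \<otimes> g) x \<in> W" using k(2) half mult[OF xX] by auto
      fix z assume z: "z \<in> insert y Y"
      show "\<exists>z'\<in>X. dist z z' < \<epsilon> \<and> \<phi> (k \<otimes> g) z' \<in> W"
      proof (cases "z = y")
        case True
        have "y0 \<in> X" "dist y y0 < \<epsilon>" using M(3) by auto
        then show ?thesis using True k(3) half mult by fastforce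
      next
        case False
        then obtain z' where z': "z' \<in> X" "dist z z' < \<epsilon>" "\<phi> g z' \<in> W'"
          using g(3) z False by blast
        have "dist (\<phi> g x) (\<phi> g z') \<le> dist c (\<phi> g x) + dist c (\<phi> g z')"
          by (metis dist_commute dist_triangle)
        then have "dist (\<phi> g x) (\<phi> g z') < \<eta>" using z'(3) g(2) by (auto simp: W'_def)
        then have "dist (\<phi> k (\<phi> g x)) (\<phi> k (\<phi> g z')) < r / 2"
          using \<eta>(2)[OF k(1)] z'(1) xX g(1) by auto
        moreover have "dist c (\<phi> k (\<phi> g x)) < r / 2" using k(2) by auto
        ultimately have "dist c (\<phi> k (\<phi> g z')) < r"
          using dist_triangle[of c "\<phi> k (\<phi> g z')" "\<phi> k (\<phi> g x)"] by linarith
        then have "\<phi> (k \<otimes> g) z' \<in> X \<inter> ball c r" using mult z'(1) kG g(1) by auto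
        then show ?thesis using z'(1,2) r(2) by blast
      qed
    qed
  qed
qed

text \<open>Lower semicontinuity spreads \<open>n\<close> separated points of the section at
  \<open>x\<close> to all \<open>z\<close> in a neighbourhood \<open>N\<close>. Every point of
  \<open>X\<close> enters \<open>N\<close> under a finite set \<open>H\<close>; invariance of
  \<open>Q\<close> pulls the points back, and equicontinuity of \<open>H\<close> bounds the loss of
  separation.\<close>

lemma uniformly_separated_Q_sections:
  fixes n :: nat
  assumes x: "generic x"
    and card: "infinite (Q `` {x}) \<or> card (Q `` {x}) \<ge> n"
  shows "\<exists>\<delta>>0. \<forall>z\<in>X. \<exists>p. (\<forall>i\<in>{1..n}. (z, p i) \<in> Q) \<and>
     (\<forall>i\<in>{1..n}. \<forall>j\<in>{1..n}. i \<noteq> j \<longrightarrow> dist (p i) (p j) \<ge> \<delta>)"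
proof -
  obtain T where T: "T \<subseteq> Q `` {x}" "finite T" "card T = n"
    using card by (metis infinite_arbitrarily_large obtain_subset_with_card_n)
  obtain y where y: "bij_betw y {1..n} T"
    using ex_bij_betw_nat_finite_1[OF T(2)] T(3) by blast
  have yQ: "(x, y i) \<in> Q" if "i \<in> {1..n}" for i
    using bij_betwE[OF y] that T(1) by blast
  \<comment> \<open>The inserted 1 keeps \<open>D\<close> nonempty when \<open>T\<close> has at most
    one point; removing 0 discards the diagonal.\<close>
  define D where "D = insert 1 ((\<lambda>(a, b). dist a b) ` (T \<times> T) - {0})"
  define d where "d = Min D"
  have finD: "finite D" "D \<noteq> {}" using T(2) by (auto simp: D_def)
  have "\<forall>t\<in>D. t > 0" by (auto simp: D_def)
  then have d0: "d > 0" unfolding d_def using finD by simp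
  have dsep: "d \<le> dist (y i) (y j)" if "i \<in> {1..n}" "j \<in> {1..n}" "i \<noteq> j" for i j
  proof -
    have "y i \<in> T" "y j \<in> T" using bij_betwE[OF y] that by blast+
    moreover have "y i \<noteq> y j" using bij_betw_imp_inj_on[OF y] that by (meson inj_onD)
    ultimately have "dist (y i) (y j) \<in> D" by (force simp: D_def)
    then show ?thesis unfolding d_def using finD(1) by simp
  qed
  have "\<exists>V. openin (top_of_set X) V \<and> x \<in> V \<and> V \<subseteq> Q_meets (closure (X \<inter> ball (y i) (d/4)))"
    if "i \<in> {1..n}" for i
    using QD(2)[OF yQ[OF that]] d0 by (intro generic_Q_meets[OF x yQ[OF that] openin_ball]) auto
  then obtain V where V: "\<And>i. i \<in> {1..n} \<Longrightarrow> openin (top_of_set X) (V i) \<and> x \<in> V i \<and>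
      V i \<subseteq> Q_meets (closure (X \<inter> ball (y i) (d/4)))"
    by metis
  \<comment> \<open>Intersecting with the whole space covers an empty index set.\<close>
  define N where "N = (\<Inter>i\<in>{1..n}. V i) \<inter> topspace (top_of_set X)"
  have N: "openin (top_of_set X) N"
    unfolding N_def using V by (intro openin_INT) auto
  have "x \<in> N" using V x by (simp add: N_def generic_def)
  then have "N \<noteq> {}" by blast
  have sepN: "\<exists>p. (\<forall>i\<in>{1..n}. (z, p i) \<in> Q) \<and>
     (\<forall>i\<in>{1..n}. \<forall>j\<in>{1..n}. i \<noteq> j \<longrightarrow> dist (p i) (p j) \<ge> d/2)" if z: "z \<in> N" for z
  proof -
    have "\<exists>p. (z, p) \<in> Q \<and> dist (y i) p \<le> d/4" if i: "i \<in> {1..n}" for i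
    proof -
      have "z \<in> Q_meets (closure (X \<inter> ball (y i) (d/4)))" using z V[OF i] i by (auto simp: N_def)
      then obtain p where p: "(z, p) \<in> Q" "p \<in> closure (X \<inter> ball (y i) (d/4))"
        by (auto simp: Q_meets_def)
      have "closure (X \<inter> ball (y i) (d/4)) \<subseteq> cball (y i) (d/4)"
        by (rule closure_minimal) auto
      then have "p \<in> cball (y i) (d/4)" using p(2) by blast
      then show ?thesis using p(1) by (auto simp only: mem_cball)
    qed
    then obtain p where p: "\<And>i. i \<in> {1..n} \<Longrightarrow> (z, p i) \<in> Q \<and> dist (y i) (p i) \<le> d/4" by metis
    have "dist (p i) (p j) \<ge> d/2" if "i \<in> {1..n}" "j \<in> {1..n}" "i \<noteq> j" for i j
    proof -
      have "dist (y i) (y j) \<le> dist (y i) (p i) + dist (p i) (p j) + dist (y j) (p j)"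
        using dist_triangle[of "y i" "y j" "p i"] dist_triangle2[of "p i" "y j" "p j"] by linarith
      then show ?thesis using dsep[OF that] p[OF that(1)] p[OF that(2)] by linarith
    qed
    then show ?thesis using p by blast
  qed
  obtain H where H: "finite H" "H \<subseteq> carrier G" "\<And>z. z \<in> X \<Longrightarrow> \<exists>h\<in>H. \<phi> h z \<in> N"
    using finite_return[OF N \<open>N \<noteq> {}\<close>] by metis
  have "d/2 > 0" using d0 by simp
  obtain \<eta> where \<eta>: "\<eta> > 0"
    "\<And>k a b. k \<in> H \<Longrightarrow> a \<in> X \<Longrightarrow> b \<in> X \<Longrightarrow> dist a b < \<eta> \<Longrightarrow> dist (\<phi> k a) (\<phi> k b) < d/2"
    using finite_action_equicontinuous[OF H(1,2) \<open>d/2 > 0\<close>] by metis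
  show ?thesis
  proof (intro exI[of _ \<eta>] conjI ballI \<eta>(1))
    fix z assume z: "z \<in> X"
    obtain h where h: "h \<in> H" "\<phi> h z \<in> N" using H(3)[OF z] by blast
    have hG: "h \<in> carrier G" using h(1) H(2) by blast
    obtain p where p: "\<forall>i\<in>{1..n}. (\<phi> h z, p i) \<in> Q"
      "\<forall>i\<in>{1..n}. \<forall>j\<in>{1..n}. i \<noteq> j \<longrightarrow> dist (p i) (p j) \<ge> d/2"
      using sepN[OF h(2)] by blast
    have pX: "p i \<in> X" if "i \<in> {1..n}" for i using QD(2) p(1) that by blast
    define q where "q = (\<lambda>i. \<phi> (inv h) (p i))"
    have "(z, q i) \<in> Q" if "i \<in> {1..n}" for i
      using Q_invariant[of "\<phi> h z" "p i" "inv h"] p(1) that z hG by (simp add: q_def)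
    moreover have "dist (q i) (q j) \<ge> \<eta>" if ij: "i \<in> {1..n}" "j \<in> {1..n}" "i \<noteq> j" for i j
    proof (rule ccontr)
      assume "\<not> ?thesis"
      then have "dist (\<phi> h (q i)) (\<phi> h (q j)) < d/2"
        using pX ij hG by (intro \<eta>(2)[OF h(1)]) (auto simp: q_def)
      then have "dist (p i) (p j) < d/2" using pX ij hG by (simp add: q_def)
      then show False using p(2) ij by fastforce
    qed
    ultimately show "\<exists>p. (\<forall>i\<in>{1..n}. (z, p i) \<in> Q) \<and>
       (\<forall>i\<in>{1..n}. \<forall>j\<in>{1..n}. i \<noteq> j \<longrightarrow> dist (p i) (p j) \<ge> \<eta>)"
      by blast
  qed
qed

text \<open>Separated points in the sections at the points \<open>\<phi> f x\<close> are pulled back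
  to the section at \<open>x\<close>, gathered approximately in \<open>U\<close> by one
  \<open>g\<close>, and spread out again by \<open>f \<otimes> inv g\<close>.\<close>

lemma thickly_sensitive_if_large_Q_sections:
  assumes dense: "\<And>U V. openin (top_of_set X) U \<Longrightarrow> openin (top_of_set X) V \<Longrightarrow> U \<noteq> {} \<Longrightarrow> V \<noteq> {}
      \<Longrightarrow> \<exists>M. minimal_pairs M \<and> M \<inter> U \<times> V \<noteq> {}"
    and card: "\<And>x. x \<in> X \<Longrightarrow> infinite (Q `` {x}) \<or> card (Q `` {x}) \<ge> n"
  shows "thickly_sensitive G X \<phi> n"
proof -
  obtain x where gx: "generic x" using generic_point_exists[OF dense] by blast
  then have x: "x \<in> X" by (simp add: generic_def)
  obtain \<delta> where \<delta>: "\<delta> > 0" "\<forall>z\<in>X. \<exists>p. (\<forall>i\<in>{1..n}. (z, p i) \<in> Q) \<and>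
     (\<forall>i\<in>{1..n}. \<forall>j\<in>{1..n}. i \<noteq> j \<longrightarrow> dist (p i) (p j) \<ge> \<delta>)"
    using uniformly_separated_Q_sections[OF gx card[OF x]] by blast
  then obtain p where p: "\<And>z i. z \<in> X \<Longrightarrow> i \<in> {1..n} \<Longrightarrow> (z, p z i) \<in> Q"
    "\<And>z i j. z \<in> X \<Longrightarrow> i \<in> {1..n} \<Longrightarrow> j \<in> {1..n} \<Longrightarrow> i \<noteq> j \<Longrightarrow> dist (p z i) (p z j) \<ge> \<delta>"
    by metis
  have "thick G (separation_times G \<phi> U (\<delta>/4) n)"
    if U: "openin (top_of_set X) U" "U \<noteq> {}" for U
    unfolding thick_def
  proof (intro conjI allI impI)
    show "separation_times G \<phi> U (\<delta>/4) n \<subseteq> carrier G" by (auto simp: separation_times_def)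
    fix F assume F: "finite F \<and> F \<subseteq> carrier G"
    \<comment> \<open>The pullback makes all chosen points partners of the single generic point
      \<open>x\<close>, as \<open>finite_Q_section_joined\<close> requires; applying
      \<open>f\<close> recovers the separated ones.\<close>
    define q where "q = (\<lambda>f i. \<phi> (inv f) (p (\<phi> f x) i))"
    define Y where "Y = (\<Union>f\<in>F. q f ` {1..n})"
    have qX: "p (\<phi> f x) i \<in> X" "q f i \<in> X" "\<phi> f (q f i) = p (\<phi> f x) i"
      if "f \<in> F" "i \<in> {1..n}" for f i
    proof -
      have "f \<in> carrier G" using F that by blast
      then show "p (\<phi> f x) i \<in> X" "q f i \<in> X" "\<phi> f (q f i) = p (\<phi> f x) i"
        using QD(2)[OF p(1)[of "\<phi> f x" i]] x that by (auto simp: q_def)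
    qed
    have YQ: "(x, y) \<in> Q" if yY: "y \<in> Y" for y
    proof -
      obtain f i where fi: "f \<in> F" "i \<in> {1..n}" "y = q f i" using yY unfolding Y_def by blast
      have f: "f \<in> carrier G" using fi F by blast
      show ?thesis
        using Q_invariant[OF p(1)[of "\<phi> f x" i], of "inv f"] f fi x by (simp add: q_def)
    qed
    have "finite Y" using F by (simp add: Y_def)
    have "\<delta>/4 > 0" using \<delta>(1) by simp
    obtain \<eta> where \<eta>: "\<eta> > 0"
      "\<And>k a b. k \<in> F \<Longrightarrow> a \<in> X \<Longrightarrow> b \<in> X \<Longrightarrow> dist a b < \<eta> \<Longrightarrow> dist (\<phi> k a) (\<phi> k b) < \<delta>/4"
      using finite_action_equicontinuous[OF conjunct1[OF F] conjunct2[OF F] \<open>\<delta>/4 > 0\<close>] by metis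
    obtain g where g: "g \<in> carrier G" "\<forall>y\<in>Y. \<exists>y'\<in>X. dist y y' < \<eta> \<and> \<phi> g y' \<in> U"
      using finite_Q_section_joined[OF gx \<eta>(1) \<open>finite Y\<close> YQ U] by blast
    then obtain r where r: "\<And>y. y \<in> Y \<Longrightarrow> r y \<in> X \<and> dist y (r y) < \<eta> \<and> \<phi> g (r y) \<in> U" by metis
    \<comment> \<open>Since \<open>g\<close> carries the perturbed points into \<open>U\<close>, the
      way from \<open>U\<close> back to them is \<open>inv g\<close>.\<close>
    have "F #>\<^bsub>G\<^esub> inv g \<subseteq> separation_times G \<phi> U (\<delta>/4) n"
    proof
      fix h assume "h \<in> F #>\<^bsub>G\<^esub> inv g"
      then obtain f where f: "f \<in> F" "h = f \<otimes> inv g" by (auto simp: r_coset_def)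
      have fG: "f \<in> carrier G" using f(1) F by blast
      define u where "u = (\<lambda>i. \<phi> g (r (q f i)))"
      have qY: "q f i \<in> Y" if "i \<in> {1..n}" for i using f(1) that unfolding Y_def by blast
      have hu: "\<phi> h (u i) = \<phi> f (r (q f i))" if "i \<in> {1..n}" for i
        using r[OF qY[OF that]] g(1) fG f(2) by (simp add: u_def action_mult)
      have near: "dist (p (\<phi> f x) i) (\<phi> h (u i)) < \<delta>/4" if i: "i \<in> {1..n}" for i
        using \<eta>(2)[OF f(1) qX(2)[OF f(1) i], of "r (q f i)"] r[OF qY[OF i]] hu[OF i] qX(3)[OF f(1) i]
        by simp
      have "dist (\<phi> h (u i)) (\<phi> h (u j)) > \<delta>/4" if ij: "1 \<le> i \<and> i < j \<and> j \<le> n" for i j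
      proof -
        have ij': "i \<in> {1..n}" "j \<in> {1..n}" "i \<noteq> j" using ij by auto
        have "dist (p (\<phi> f x) i) (p (\<phi> f x) j) \<ge> \<delta>"
          using p(2)[of "\<phi> f x"] x fG ij' by auto
        moreover have "dist (p (\<phi> f x) i) (p (\<phi> f x) j) \<le> dist (p (\<phi> f x) i) (\<phi> h (u i)) +
            dist (\<phi> h (u i)) (\<phi> h (u j)) + dist (p (\<phi> f x) j) (\<phi> h (u j))"
          using dist_triangle[of "p (\<phi> f x) i" "p (\<phi> f x) j" "\<phi> h (u i)"]
            dist_triangle2[of "\<phi> h (u i)" "p (\<phi> f x) j" "\<phi> h (u j)"] by linarith
        \<comment> \<open>Two errors below \<open>\<delta>/4\<close> leave more than
          \<open>\<delta>/2\<close>, which exceeds the constant \<open>\<delta>/4\<close>.\<close>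
        ultimately show ?thesis using near[OF ij'(1)] near[OF ij'(2)] \<delta>(1) by linarith
      qed
      moreover have "\<forall>i\<in>{1..n}. u i \<in> U" using r qY by (simp add: u_def)
      moreover have "h \<in> carrier G" using fG g(1) f(2) by simp
      ultimately show "h \<in> separation_times G \<phi> U (\<delta>/4) n"
        unfolding separation_times_def by blast
    qed
    then show "\<exists>g\<in>carrier G. F #>\<^bsub>G\<^esub> g \<subseteq> separation_times G \<phi> U (\<delta>/4) n"
      using g(1) by blast
  qed
  then show ?thesis unfolding thickly_sensitive_def using \<delta>(1) by (intro exI[of _ "\<delta>/4"]) auto
qed

section \<open>Necessity: separated points close to a section\<close>

text \<open>If no bound works, there are points \<open>z k\<close> tending to \<open>x\<close> whose
  partners \<open>p k\<close> stay at distance at least \<open>\<eta>\<close> from the section; but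
  a limit point of the partners lies in the section.\<close>

lemma asymptotic_pairs_near_Q_section:
  assumes x: "x \<in> X" and "\<eta> > 0"
  obtains \<epsilon> where "\<epsilon> > 0"
    "\<And>z p g. z \<in> X \<Longrightarrow> p \<in> X \<Longrightarrow> g \<in> carrier G \<Longrightarrow> dist x z < \<epsilon> \<Longrightarrow>
       dist (\<phi> g z) (\<phi> g p) < \<epsilon> \<Longrightarrow> \<exists>y. (x, y) \<in> Q \<and> dist y p < \<eta>"
proof (rule ccontr)
  note thesis = that
  assume neg: "\<not> thesis"
  have "\<exists>z p g. z \<in> X \<and> p \<in> X \<and> g \<in> carrier G \<and> dist x z < inverse (real (Suc k)) \<and>
      dist (\<phi> g z) (\<phi> g p) < inverse (real (Suc k)) \<and> (\<forall>y. (x, y) \<in> Q \<longrightarrow> dist y p \<ge> \<eta>)" for k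
  proof (rule ccontr)
    assume *: "\<not> ?thesis"
    have thesis
    proof (rule thesis[of "inverse (real (Suc k))"])
      fix z p g assume "z \<in> X" "p \<in> X" "g \<in> carrier G" "dist x z < inverse (real (Suc k))"
        "dist (\<phi> g z) (\<phi> g p) < inverse (real (Suc k))"
      then show "\<exists>y. (x, y) \<in> Q \<and> dist y p < \<eta>" using * by (meson not_less)
    qed simp
    then show False using neg by simp
  qed
  then obtain z p g where k: "\<And>k. z k \<in> X" "\<And>k. p k \<in> X" "\<And>k. g k \<in> carrier G"
    "\<And>k. dist x (z k) < inverse (real (Suc k))"
    "\<And>k. dist (\<phi> (g k) (z k)) (\<phi> (g k) (p k)) < inverse (real (Suc k))"
    "\<And>k y. (x, y) \<in> Q \<Longrightarrow> dist y (p k) \<ge> \<eta>"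
    by metis
  obtain l s where l: "l \<in> X" "strict_mono (s :: nat \<Rightarrow> nat)" "(p \<circ> s) \<longlonglongrightarrow> l"
    using compact_space k(2) unfolding compact_eq_seq_compact_metric seq_compact_def by metis
  have "(x, l) \<in> Q"
    unfolding Q_iff
  proof (intro conjI x l(1) allI impI)
    fix e :: real assume "e > 0"
    obtain N where N: "\<And>m. m \<ge> N \<Longrightarrow> dist (p (s m)) l < e"
      using l(3) \<open>e > 0\<close> unfolding lim_sequentially by auto
    obtain M where M: "inverse (real (Suc M)) < e" using reals_Archimedean[OF \<open>e > 0\<close>] by auto
    define m where "m = max N M"
    \<comment> \<open>Subsequence indices satisfy \<open>m \<le> s m\<close>, so the bounds at
      \<open>s m\<close> are at least as good as the one at \<open>M\<close>.\<close>
    have "M \<le> s m" using seq_suble[OF l(2), of m] by (simp add: m_def)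
    then have "inverse (real (Suc (s m))) \<le> inverse (real (Suc M))" by (intro le_imp_inverse_le) auto
    then have lt: "inverse (real (Suc (s m))) < e" using M by linarith
    have "dist l (p (s m)) < e" using N[of m] by (simp add: m_def dist_commute)
    moreover have "dist x (z (s m)) < e" using k(4)[of "s m"] lt by linarith
    moreover have "dist (\<phi> (g (s m)) (z (s m))) (\<phi> (g (s m)) (p (s m))) < e"
      using k(5)[of "s m"] lt by linarith
    ultimately show "\<exists>x'\<in>X. \<exists>y'\<in>X. \<exists>g\<in>carrier G. dist x x' < e \<and> dist l y' < e \<and> dist (\<phi> g x') (\<phi> g y') < e"
      using k(1-3) by blast
  qed
  then have "\<And>k. dist l (p k) \<ge> \<eta>" using k(6) by blast
  moreover obtain N where "dist (p (s N)) l < \<eta>"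
    using l(3) \<open>\<eta> > 0\<close> unfolding lim_sequentially by auto
  ultimately show False by (metis dist_commute not_less)
qed

text \<open>One \<open>h\<close> both returns \<open>x\<close> to \<open>U\<close> and separates
  points \<open>u i\<close> of \<open>U\<close>. Under \<open>inv h\<close> the points
  \<open>\<phi> h x\<close> and \<open>\<phi> h (u i)\<close> go back to the close points
  \<open>x\<close> and \<open>u i\<close>, so each \<open>\<phi> h (u i)\<close> is within
  \<open>\<delta>/2\<close> of the section at \<open>x\<close>. Separation above
  \<open>\<delta>\<close> then keeps the nearby section points distinct.\<close>

lemma large_Q_section_if_thickly_sensitive:
  assumes sens: "thickly_sensitive G X \<phi> n" and x: "x \<in> X" and fin: "finite (Q `` {x})"
  shows "card (Q `` {x}) \<ge> n"
proof -
  obtain \<delta> where \<delta>: "\<delta> > 0"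
    "\<And>U. openin (top_of_set X) U \<Longrightarrow> U \<noteq> {} \<Longrightarrow> thick G (separation_times G \<phi> U \<delta> n)"
    using sens unfolding thickly_sensitive_def by blast
  have "\<delta>/2 > 0" using \<delta>(1) by simp
  obtain \<epsilon> where \<epsilon>: "\<epsilon> > 0"
    "\<And>z p g. z \<in> X \<Longrightarrow> p \<in> X \<Longrightarrow> g \<in> carrier G \<Longrightarrow> dist x z < \<epsilon> \<Longrightarrow>
       dist (\<phi> g z) (\<phi> g p) < \<epsilon> \<Longrightarrow> \<exists>y. (x, y) \<in> Q \<and> dist y p < \<delta>/2"
    using asymptotic_pairs_near_Q_section[OF x \<open>\<delta>/2 > 0\<close>] by metis
  define U where "U = X \<inter> ball x \<epsilon>"
  have U: "openin (top_of_set X) U" "U \<noteq> {}" using x \<epsilon>(1) by (auto simp: U_def)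
  \<comment> \<open>Thickness is applied to a set of return times to \<open>U\<close>, so that
    \<open>f\<close> can be chosen after \<open>g\<close>, according to where \<open>g\<close> sends
    \<open>x\<close>.\<close>
  obtain F where F: "finite F" "F \<subseteq> carrier G" "\<And>z. z \<in> X \<Longrightarrow> \<exists>f\<in>F. \<phi> f z \<in> U"
    using finite_return[OF U] by metis
  obtain g where g: "g \<in> carrier G" "F #>\<^bsub>G\<^esub> g \<subseteq> separation_times G \<phi> U \<delta> n"
    using \<delta>(2)[OF U] F(1,2) unfolding thick_def by blast
  obtain f where f: "f \<in> F" "\<phi> f (\<phi> g x) \<in> U" using F(3)[of "\<phi> g x"] g(1) x by blast
  define h where "h = f \<otimes> g"
  have fG: "f \<in> carrier G" using f(1) F(2) by blast
  have hG: "h \<in> carrier G" using fG g(1) by (simp add: h_def)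
  have hx: "\<phi> h x \<in> U" using f(2) action_mult[OF fG g(1) x] by (simp add: h_def)
  have "h \<in> F #>\<^bsub>G\<^esub> g" using f(1) by (auto simp: h_def r_coset_def)
  then have "h \<in> separation_times G \<phi> U \<delta> n" using g(2) by blast
  then obtain u where u: "\<forall>i\<in>{1..n}. u i \<in> U"
    "\<forall>i j. 1 \<le> i \<and> i < j \<and> j \<le> n \<longrightarrow> dist (\<phi> h (u i)) (\<phi> h (u j)) > \<delta>"
    unfolding separation_times_def by blast
  have "\<exists>y. (x, y) \<in> Q \<and> dist y (\<phi> h (u i)) < \<delta>/2" if i: "i \<in> {1..n}" for i
  proof (rule \<epsilon>(2)[of "\<phi> h x" _ "inv h"])
    have "u i \<in> X" "dist x (u i) < \<epsilon>" using u(1) i by (auto simp: U_def)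
    then show "\<phi> h (u i) \<in> X" "dist (\<phi> (inv h) (\<phi> h x)) (\<phi> (inv h) (\<phi> h (u i))) < \<epsilon>"
      using hG x by auto
    show "\<phi> h x \<in> X" "dist x (\<phi> h x) < \<epsilon>" "inv h \<in> carrier G" using hx hG by (auto simp: U_def)
  qed
  then obtain y where y: "\<And>i. i \<in> {1..n} \<Longrightarrow> (x, y i) \<in> Q \<and> dist (y i) (\<phi> h (u i)) < \<delta>/2" by metis
  have ne: "y i \<noteq> y j" if "1 \<le> i \<and> i < j \<and> j \<le> n" for i j
  proof
    assume eq: "y i = y j"
    have "dist (\<phi> h (u i)) (\<phi> h (u j)) \<le> dist (y i) (\<phi> h (u i)) + dist (y j) (\<phi> h (u j))"
      using dist_triangle3[of "\<phi> h (u i)" "\<phi> h (u j)" "y i"] eq by simp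
    moreover have "dist (y i) (\<phi> h (u i)) < \<delta>/2" "dist (y j) (\<phi> h (u j)) < \<delta>/2"
      using y that by auto
    moreover have "dist (\<phi> h (u i)) (\<phi> h (u j)) > \<delta>" using u(2) that by blast
    ultimately show False by linarith
  qed
  have "inj_on y {1..n}"
    by (rule inj_onI) (metis ne atLeastAtMost_iff linorder_neqE_nat)
  moreover have "y ` {1..n} \<subseteq> Q `` {x}" using y by auto
  ultimately have "card {1..n} \<le> card (Q `` {x})" using fin by (rule card_inj_on_le)
  then show ?thesis by simp
qed

section \<open>The density hypothesis in terms of open boxes\<close>

text \<open>A box is open in the product, so it contains a minimal point, which brings along its
  minimal set.\<close>

lemma dense_minimal_pairs:
  assumes "top_of_set XX closure_of {p \<in> XX. minimal_point G XX \<phi>\<phi> p} = XX"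
    and "openin (top_of_set X) U" "openin (top_of_set X) V" "U \<noteq> {}" "V \<noteq> {}"
  shows "\<exists>M. minimal_pairs M \<and> M \<inter> U \<times> V \<noteq> {}"
proof -
  have op: "openin (top_of_set XX) (U \<times> V)" using assms(2,3) by (rule openin_Times)
  obtain a where a: "a \<in> U \<times> V" using assms(4,5) by blast
  then have "a \<in> XX" using openin_imp_subset[OF op] by blast
  then have "a \<in> top_of_set XX closure_of {p \<in> XX. minimal_point G XX \<phi>\<phi> p}" using assms(1) by simp
  then have "\<forall>T. a \<in> T \<and> openin (top_of_set XX) T \<longrightarrow>
      (\<exists>p. p \<in> {p \<in> XX. minimal_point G XX \<phi>\<phi> p} \<and> p \<in> T)"
    unfolding in_closure_of by (rule conjunct2)
  from mp[OF spec[OF this] conjI[OF a op]]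
  obtain p where p: "p \<in> U \<times> V" "minimal_point G XX \<phi>\<phi> p" by blast
  then obtain M where "minimal_pairs M" "p \<in> M"
    unfolding minimal_point_def minimal_pairs_def by blast
  then show ?thesis using p(1) by blast
qed

end

theorem theorem2:
  fixes G :: "('g, 'b) monoid_scheme"
    and X :: "'a::metric_space set"
    and \<phi> :: "'g \<Rightarrow> 'a \<Rightarrow> 'a"
    and n :: nat
  assumes "minimal_system G X \<phi>"
    and "n \<ge> 2"
    and "top_of_set (X \<times> X) closure_of
           {p \<in> X \<times> X. minimal_point G (X \<times> X) (diagonal_action X \<phi>) p} = X \<times> X"
  shows "thickly_sensitive G X \<phi> n \<longleftrightarrow>
           (\<forall>x\<in>X. infinite (regionally_proximal G X \<phi> `` {x}) \<or>
                  card (regionally_proximal G X \<phi> `` {x}) \<ge> n)"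
proof -
  interpret minimal_dynamical_system G X \<phi>
    using assms(1)
    by (simp add: minimal_dynamical_system_def minimal_dynamical_system_axioms_def minimal_system_def)
  show ?thesis
    using large_Q_section_if_thickly_sensitive
      thickly_sensitive_if_large_Q_sections[OF dense_minimal_pairs[OF assms(3)]]
    by blast
qed

end
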